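(* Let $q\geq 223$ be a prime power. Then every $b\in\mathbb{F}_{q^5}^*$ can be written as $$b=\frac{uv^q-u^qv}{u^{q^2}v-uv^{q^2}}$$ for some $u,v\in\mathbb{F}_{q^5}^*$ such that $\dim_{\mathbb{F}_q}\langle u,v\rangle_{\mathbb{F}_q}=2$.
   Context: $\langle u,v\rangle_{\mathbb{F}_q}$ denotes the $\mathbb{F}_q$-subspace of $\mathbb{F}_{q^5}$ spanned by $u$ and $v$. *)

theory Defs
  imports
    "HOL-Computational_Algebra.Computational_Algebra"
    "HOL-Number_Theory.Number_Theory"
begin

(* The subfield of order q is presented as a finite field type embedded in the
   extension field, so that linear algebra over it can use the vector_space locale,
   whose scalars form a type of class field.  The embedding is necessarily
   injective, as fields have only the trivial proper ideal. *)

definition field_embedding :: "('k::field \<Rightarrow> 'a::field) \<Rightarrow> bool" where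
  "field_embedding \<iota> \<longleftrightarrow>
     \<iota> 1 = 1 \<and> (\<forall>x y. \<iota> (x + y) = \<iota> x + \<iota> y) \<and> (\<forall>x y. \<iota> (x * y) = \<iota> x * \<iota> y)"

definition ext_scale :: "('k::field \<Rightarrow> 'a::field) \<Rightarrow> 'k \<Rightarrow> 'a \<Rightarrow> 'a" where
  "ext_scale \<iota> c x = \<iota> c * x"

lemma vector_space_ext_scale:
  assumes "field_embedding \<iota>"
  shows "vector_space (ext_scale \<iota>)"
  using assms
  by unfold_locales (auto simp: field_embedding_def ext_scale_def algebra_simps)

abbreviation ext_span :: "('k::field \<Rightarrow> 'a::field) \<Rightarrow> 'a set \<Rightarrow> 'a set" where
  "ext_span \<iota> \<equiv> module.span (ext_scale \<iota>)"

abbreviation ext_dim :: "('k::field \<Rightarrow> 'a::field) \<Rightarrow> 'a set \<Rightarrow> nat" where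
  "ext_dim \<iota> \<equiv> vector_space.dim (ext_scale \<iota>)"

end

theory Submission
  imports "HOL-Algebra.Algebraic_Closure_Type" Defs
begin

text \<open>
  Write \<open>x\<^sub>i\<close> for \<open>x ^ (q ^ i)\<close> and \<open>N x\<close> for \<open>x\<^sub>0 x\<^sub>1 x\<^sub>2 x\<^sub>3 x\<^sub>4\<close>.  If \<open>u\<close> and \<open>v\<close> span the root space of
  \<open>w\<^sub>2 - \<alpha> w\<^sub>1 + \<beta> w\<close>, then expanding \<open>u\<^sub>2\<close> and \<open>v\<^sub>2\<close> gives \<open>u\<^sub>2 v - u v\<^sub>2 = - \<alpha> (u v\<^sub>1 - u\<^sub>1 v)\<close>, so the quotient in
  the theorem equals \<open>- 1 / \<alpha>\<close>.  Hence, with \<open>\<alpha> = - 1 / b\<close>, it suffices to find \<open>\<beta> \<noteq> 0\<close> for which this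
  \<open>q\<close>-polynomial has all its \<open>q\<^sup>2\<close> roots in the field with \<open>q ^ 5\<close> elements: \<open>u\<close> is then any nonzero root and
  \<open>v\<close> any root that is not an \<open>\<iota>\<close>-multiple of \<open>u\<close>.

  The roots satisfy \<open>w\<^sub>i\<^sub>+\<^sub>2 = \<alpha>\<^sub>i w\<^sub>i\<^sub>+\<^sub>1 - \<beta>\<^sub>i w\<^sub>i\<close>, and the condition is that this recurrence has period five.  Its five
  steps compose to the identity if \<open>\<beta> = \<alpha> \<alpha>\<^sub>4 (1 + s\<^sub>4)\<close>, where \<open>s\<close> satisfies the pentagonal recurrence
  \<open>s s\<^sub>2 = 1 + s\<^sub>1\<close> and has \<open>N s = 1 / N \<alpha>\<close> (\<open>exists_q_polynomial_split_by_period_5\<close>).  Geometrically, a plane in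
  five-space up to rescaling of the coordinates is a point of the del Pezzo surface of degree five, i.e. of
  the moduli space of five points on a line, and \<open>s\<close> is a cross ratio of these points.

  It remains to find \<open>s\<close> with prescribed \<open>N s = c\<close>.  The points \<open>(s, t)\<close> with \<open>(1 + s) (1 + t) (1 + s + t) = c s t\<close>
  form, for general \<open>c\<close>, an elliptic curve on which \<open>(s, t) \<mapsto> (t, (1 + t) / s)\<close> is the translation by a point of
  order five, and a point is needed which Frobenius translates in this way.  Lang's theorem provides it, and
  its proof becomes elementary here.  Over the algebraic closure, choose \<open>s\<close> with \<open>(s, s\<^sub>1)\<close> on the curve; then
  \<open>(s\<^sub>1, s\<^sub>2)\<close> is on the curve as well, and since the equation is symmetric and quadratic in each variable, \<open>s\<^sub>2\<close> is
  either \<open>(1 + s\<^sub>1) / s\<close>, as required, or \<open>s\<close>.  The second case cannot occur for every choice of \<open>s\<close>:  there would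
  be \<open>2 q + 1\<close> choices, all simple roots of a polynomial, but each has \<open>s + s\<^sub>1\<close> in the field with \<open>q\<close> elements,
  and each value of \<open>s + s\<^sub>1\<close> belongs to at most two of them (\<open>exists_pentagon_orbit_of_norm\<close>).
\<close>

section \<open>Counting roots of polynomials\<close>

lemma degree_diff_eq_left:
  fixes p r :: "'a::ab_group_add poly"
  shows "degree r < degree p \<Longrightarrow> degree (p - r) = degree p"
  using degree_add_eq_left[of "- r" p] by simp

lemma card_roots_eq_degree_if_separable:
  fixes p :: "'f::alg_closed_field poly"
  assumes "p \<noteq> 0" and sep: "\<And>x. poly p x = 0 \<Longrightarrow> poly (pderiv p) x \<noteq> 0"
  shows "card {x. poly p x = 0} = degree p"
proof -
  obtain A l where A: "size A = degree p" and p: "p = smult l (\<Prod>x\<in>#A. [:-x, 1:])"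
    using alg_closed_imp_factorization[OF \<open>p \<noteq> 0\<close>] by blast
  have roots: "{x. poly p x = 0} = set_mset A"
    using \<open>p \<noteq> 0\<close> by (auto simp: p poly_prod_mset)
  have "count A x = 1" if x: "x \<in># A" for x
  proof (rule ccontr)
    assume "count A x \<noteq> 1"
    obtain B where B: "A = add_mset x B"
      using multi_member_split[OF x] by blast
    with \<open>count A x \<noteq> 1\<close> have "x \<in># B"
      by (simp flip: count_greater_zero_iff)
    then obtain C where C: "B = add_mset x C"
      using multi_member_split[OF \<open>x \<in># B\<close>] by blast
    define r where "r = smult l (\<Prod>y\<in>#C. [:-y, 1:])"
    have "p = [:-x, 1:] * ([:-x, 1:] * r)"
      by (simp only: p B C r_def image_mset_add_mset prod_mset.add_mset mult_smult_right)
    hence "poly p x = 0" "poly (pderiv p) x = 0"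
      by (simp_all add: pderiv_mult del: mult_pCons_left)
    with sep show False by blast
  qed
  hence "size A = card (set_mset A)"
    by (simp add: size_multiset_overloaded_eq)
  thus ?thesis using A roots by simp
qed

lemma
  fixes N :: nat
  assumes "N \<ge> 2"
  shows finite_power_fixed_points: "finite {x :: 'a::idom. x ^ N = x}"
    and card_power_fixed_points_le: "card {x :: 'a. x ^ N = x} \<le> N"
proof -
  define p :: "'a poly" where "p = monom 1 N - [:0, 1:]"
  have deg: "degree p = N"
    unfolding p_def using assms by (subst degree_diff_eq_left) (auto simp: degree_monom_eq)
  have "p \<noteq> 0" using deg assms by auto
  moreover have "{x. x ^ N = x} = {x. poly p x = 0}"
    by (simp add: p_def poly_monom)
  ultimately show "finite {x :: 'a. x ^ N = x}" "card {x :: 'a. x ^ N = x} \<le> N"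
    using poly_roots_finite[of p] card_poly_roots_bound[of p] deg by auto
qed

text \<open>
  A finite field with \<open>N\<close> elements exhausts the roots of \<open>X ^ N - X\<close> in any extension field, so membership
  in it can be tested by taking powers.  This is applied to \<open>\<iota>\<close>, and to the embedding of a finite field
  into its algebraic closure.
\<close>

lemma range_eq_power_fixed_points:
  fixes h :: "'k::finite_field \<Rightarrow> 'a::idom"
  assumes "inj h" and pow: "\<And>x n. h (x ^ n) = h x ^ n"
  shows "range h = {x. x ^ card (UNIV :: 'k set) = x}"
proof (rule card_seteq)
  have "card {0, 1 :: 'k} \<le> card (UNIV :: 'k set)"
    by (rule card_mono) auto
  hence N: "card (UNIV :: 'k set) \<ge> 2" by simp
  show "finite {x :: 'a. x ^ card (UNIV :: 'k set) = x}"
    by (rule finite_power_fixed_points[OF N])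
  show "range h \<subseteq> {x. x ^ card (UNIV :: 'k set) = x}"
    by (auto simp: finite_field_power_card_eq_same simp flip: pow)
  show "card {x :: 'a. x ^ card (UNIV :: 'k set) = x} \<le> card (range h)"
    using card_power_fixed_points_le[OF N] assms(1) by (simp add: card_image)
qed

section \<open>Pentagonal recurrences\<close>

text \<open>
  The map \<open>(x, y) \<mapsto> (y, (1 + y) / x)\<close> has order five (Gauss's pentagramma mirificum), and the product
  of the five numbers of an orbit is the rational function \<open>(1 + x) (1 + y) (1 + x + y) / (x y)\<close> of any two
  consecutive ones.  The key intermediate identity is \<open>a0 a1 a3 = 1 + a0 + a1\<close>.
\<close>

lemma pentagon_recurrence:
  fixes a0 a1 a2 a3 a4 a5 :: "'f::field"
  assumes "a0 * a2 = 1 + a1" "a1 * a3 = 1 + a2" "a2 * a4 = 1 + a3" "a3 * a5 = 1 + a4"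
    and nz: "a0 \<noteq> 0" "a1 \<noteq> 0" "a2 \<noteq> 0" "a3 \<noteq> 0"
  shows "a5 = a0" "a1 * a4 = 1 + a0" 
    "(1 + a0) * (1 + a1) * (1 + a0 + a1) = (a0 * a1 * a2 * a3 * a4) * a0 * a1"
proof -
  have 3: "a0 * a1 * a3 = 1 + a0 + a1"
    using assms(1,2) by (simp add: mult.assoc distrib_left)
  have "a0 * a2 * (a1 * a4) = a0 * a2 * (1 + a0)"
    using assms(1,3) 3 by Groebner_Basis.algebra
  thus 4: "a1 * a4 = 1 + a0" using nz by simp
  have "a1 * a3 * a5 = a1 * a3 * a0"
    using assms(4) 3 4 by Groebner_Basis.algebra
  thus "a5 = a0" using nz by simp
  show "(1 + a0) * (1 + a1) * (1 + a0 + a1) = (a0 * a1 * a2 * a3 * a4) * a0 * a1"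
    using assms(1) 3 4 by Groebner_Basis.algebra
qed

section \<open>The Frobenius map on an algebraically closed field\<close>

locale frobenius_power =
  fixes F :: "'f::alg_closed_field \<Rightarrow> 'f" and q n :: nat
  assumes F_def: "F x = x ^ q"
    and q_def: "q = CHAR('f) ^ n"
    and n_pos: "n > 0"
    and char_pos: "CHAR('f) > 0"
begin

lemma prime_char: "prime CHAR('f)"
  by (rule prime_CHAR_semidom[OF char_pos])

lemma q_ge_2: "q \<ge> 2"
proof -
  have "CHAR('f) ^ 1 \<le> q"
    unfolding q_def using n_pos char_pos by (intro power_increasing) auto
  thus ?thesis using prime_ge_2_nat[OF prime_char] by simp
qed

lemma of_nat_q: "of_nat q = (0 :: 'f)"
  using n_pos by (simp add: q_def power_0_left)

lemma F_add [simp]: "F (x + y) = F x + F y"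
  using freshmans_dream'[OF prime_char q_def] by (simp add: F_def)

lemma F_mult [simp]: "F (x * y) = F x * F y"
  by (simp add: F_def power_mult_distrib)

lemma F_0 [simp]: "F 0 = 0" and F_1 [simp]: "F 1 = 1"
  and F_eq_0_iff [simp]: "F x = 0 \<longleftrightarrow> x = 0"
  using q_ge_2 by (auto simp: F_def)

lemma F_diff [simp]: "F (x - y) = F x - F y"
  using F_add[of "x - y" y] by (simp add: algebra_simps)

lemma F_eq_iff [simp]: "F x = F y \<longleftrightarrow> x = y"
  using F_eq_0_iff[of "x - y"] by (simp del: F_eq_0_iff) 

lemma F_inverse [simp]: "F (inverse x) = inverse (F x)"
  by (simp add: F_def power_inverse)

section \<open>Lang's theorem for the pentagonal curves\<close>

text \<open>
  The two conditions on \<open>s\<close> say that Frobenius moves the point \<open>(s, F s)\<close> of the curve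
  \<open>(1 + x) (1 + y) (1 + x + y) = c x y\<close> to \<open>(F s, (1 + F s) / s)\<close>.  Any root of the polynomial \<open>P\<close> below gives a
  point \<open>(s, F s)\<close> of the curve; only the solutions with \<open>F (F s) = s\<close> have to be avoided, which is achieved by
  counting them.
\<close>

lemma exists_pentagon_orbit_of_norm:
  assumes "F c = c" and "c \<noteq> 0"
  obtains s where "s * F (F s) = 1 + F s" "(1 + s) * (1 + F s) * (1 + s + F s) = c * s * F s"
proof -
  define T Tq P :: "'f poly" where "T = [:0, 1:]" and "Tq = monom 1 q"
    and "P = (1 + T) * (1 + Tq) * (1 + T + Tq) - smult c (T * Tq)"
  have poly_P: "poly P s = (1 + s) * (1 + F s) * (1 + s + F s) - c * s * F s" for s
    by (simp add: P_def T_def Tq_def poly_monom F_def)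
  have deg_Tq: "degree Tq = q" and deg_T: "degree T = 1"
    by (simp_all add: Tq_def T_def degree_monom_eq)
  have deg1T: "degree (1 + T) = 1"
    by (simp add: T_def one_pCons)
  have deg1Tq: "degree (1 + Tq) = q"
    using deg_Tq q_ge_2 by (subst degree_add_eq_right) auto
  have deg1TTq: "degree (1 + T + Tq) = q"
    using deg_Tq deg1T q_ge_2 by (subst degree_add_eq_right) auto
  have ne: "1 + T \<noteq> 0" "1 + Tq \<noteq> 0" "1 + T + Tq \<noteq> 0"
    using deg1T deg1Tq deg1TTq q_ge_2 by auto
  have "degree ((1 + T) * (1 + Tq) * (1 + T + Tq)) = 2 * q + 1"
    using ne by (subst degree_mult_eq, simp, simp, subst degree_mult_eq) (simp_all add: deg1T deg1Tq deg1TTq)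
  moreover have "degree (smult c (T * Tq)) < 2 * q + 1"
    using degree_mult_le[of T Tq] degree_smult_le[of c "T * Tq"] deg_T deg_Tq q_ge_2 by linarith
  ultimately have deg_P: "degree P = 2 * q + 1"
    unfolding P_def by (subst degree_diff_eq_left) auto
  hence "P \<noteq> 0" by auto
  have "pderiv Tq = 0"
    by (simp add: Tq_def pderiv_monom of_nat_q)
  moreover have "pderiv T = 1"
    by (simp add: T_def pderiv_pCons)
  ultimately have pderiv_P:
    "poly (pderiv P) s = (1 + F s) * (1 + s + F s) + (1 + s) * (1 + F s) - c * F s" for s
    by (simp add: P_def pderiv_mult pderiv_add pderiv_diff pderiv_smult)
       (simp add: T_def Tq_def poly_monom F_def algebra_simps)

  note orbit = that
  show thesis
  proof (rule ccontr)
    assume no_thesis: "\<not> thesis"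
    have no_orbit: "s * F (F s) \<noteq> 1 + F s" if "poly P s = 0" for s
      using orbit[of s] no_thesis that by (auto simp: poly_P)
    have root: "s \<noteq> 0 \<and> F s \<noteq> - 1 \<and> F (F s) = s" if s: "poly P s = 0" for s
    proof -
      have G: "(1 + s) * (1 + F s) * (1 + s + F s) = c * s * F s"
        using s by (simp add: poly_P)
      have s0: "s \<noteq> 0" using G by auto
      have s1: "1 + F s \<noteq> 0" using G s0 \<open>c \<noteq> 0\<close> by auto
      have "F ((1 + s) * (1 + F s) * (1 + s + F s)) = F (c * s * F s)"
        by (simp only: G)
      hence G': "(1 + F s) * (1 + F (F s)) * (1 + F s + F (F s)) = c * F s * F (F s)"
        using assms by simp
      \<comment> \<open>Both \<open>s\<close> and \<open>F (F s)\<close> are roots of the quadratic which the curve equation becomes when one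
        coordinate is \<open>F s\<close>, and the product of its two roots is \<open>1 + F s\<close>.\<close>
      have "(1 + F s) * (s - F (F s)) * (1 + F s - s * F (F s)) =
        s * ((1 + F s) * (1 + F (F s)) * (1 + F s + F (F s)) - c * F s * F (F s))
        - F (F s) * ((1 + s) * (1 + F s) * (1 + s + F s) - c * s * F s)"
        by (simp add: algebra_simps)
      also have "\<dots> = 0" using G G' by simp
      finally have "F (F s) = s"
        using s1 no_orbit[OF s] by auto
      thus ?thesis using s0 s1 by (metis add.right_inverse)
    qed
    have "card {s. poly P s = 0} = degree P"
    proof (rule card_roots_eq_degree_if_separable[OF \<open>P \<noteq> 0\<close>])
      fix s assume s: "poly P s = 0"
      show "poly (pderiv P) s \<noteq> 0"
      proof
        assume d: "poly (pderiv P) s = 0"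
        have r: "s \<noteq> 0" "1 + F s \<noteq> 0" "F (F s) = s"
          using root[OF s] by (auto simp: add_eq_0_iff)
        \<comment> \<open>As \<open>F s\<close> has derivative zero, a multiple root \<open>s\<close> of \<open>P\<close> is a double root of the quadratic
          with \<open>F s\<close> as its other variable, so its square is the product \<open>1 + F s\<close> of the roots.\<close>
        have "(1 + F s) * (s\<^sup>2 - (1 + F s)) = s * poly (pderiv P) s - poly P s"
          unfolding pderiv_P poly_P by (simp add: algebra_simps power2_eq_square)
        hence sq: "s * s = 1 + F s"
          using s d r by (simp add: power2_eq_square)
        have "F (s * s) = F (1 + F s)" by (simp only: sq)
        hence sq': "F s * F s = 1 + s" using r by simp
        have "(s - F s) * (1 + s + F s) = (s * s - (1 + F s)) - (F s * F s - (1 + s))"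
          by (simp add: algebra_simps)
        hence "s = F s \<or> 1 + s + F s = 0" using sq sq' by simp
        thus False
        proof
          assume "s = F s"
          thus False using no_orbit[OF s] sq r by simp
        next
          assume "1 + s + F s = 0"
          thus False using s r \<open>c \<noteq> 0\<close> by (simp add: poly_P)
        qed
      qed
    qed
    moreover have "card {s. poly P s = 0} \<le> 2 * q"
    proof -
      define E where "E = {e. F e = e}"
      have fin_E: "finite E" and card_E: "card E \<le> q"
        using finite_power_fixed_points[OF q_ge_2] card_power_fixed_points_le[OF q_ge_2]
        by (auto simp: E_def F_def)
      define fib where "fib = (\<lambda>e. {s. poly P s = 0 \<and> s + F s = e})"
      have fib: "finite (fib e) \<and> card (fib e) \<le> 2" for e
      proof (cases "fib e = {}")
        case False
        then obtain s where s: "poly P s = 0" "s + F s = e" by (auto simp: fib_def)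
        have "fib e \<subseteq> {s, F s}"
        proof
          fix t assume "t \<in> fib e"
          hence t: "poly P t = 0" "t + F t = e" by (auto simp: fib_def)
          \<comment> \<open>On the curve, the sum of the coordinates determines their product.\<close>
          have eq: "(1 + e) * (1 + e) + (1 + e - c) * (x * F x) = 0"
            if "poly P x = 0" "x + F x = e" for x
            using that(1) unfolding poly_P by (simp flip: that(2) add: algebra_simps)
          have "1 + e - c \<noteq> 0"
            using eq[OF s] \<open>c \<noteq> 0\<close> by auto
          moreover have "(1 + e - c) * (s * F s - t * F t) = 0"
            using eq[OF s] eq[OF t] by Groebner_Basis.algebra
          ultimately have "s * F s = t * F t" by simp
          moreover have "(t - s) * (t - F s) = t * t - t * (s + F s) + s * F s"
            by (simp add: algebra_simps)
          moreover have "t * t - t * (t + F t) + t * F t = 0"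
            by (simp add: algebra_simps)
          ultimately have "(t - s) * (t - F s) = 0"
            using s t by simp
          thus "t \<in> {s, F s}" by auto
        qed
        moreover have "card {s, F s} \<le> 2" by (simp add: card_insert_if)
        ultimately show ?thesis
          by (meson card_mono finite.emptyI finite.insertI finite_subset order_trans)
      qed auto
      have "{s. poly P s = 0} \<subseteq> (\<Union>e\<in>E. fib e)"
        using root by (auto simp: E_def fib_def add.commute)
      hence "card {s. poly P s = 0} \<le> card (\<Union>e\<in>E. fib e)"
        using fin_E fib by (intro card_mono) auto
      also have "\<dots> \<le> (\<Sum>e\<in>E. card (fib e))"
        using fin_E by (intro card_UN_le)
      also have "\<dots> \<le> (\<Sum>e\<in>E. 2)"
        using fib by (intro sum_mono) auto
      also have "\<dots> \<le> 2 * q"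
        using card_E by simp
      finally show ?thesis .
    qed
    ultimately show False using deg_P by simp
  qed
qed

section \<open>Splitting \<open>q\<close>-polynomials of degree \<open>q\<^sup>2\<close>\<close>

text \<open>
  The parameter \<open>\<beta>\<close> comes from Plucker coordinates: writing \<open>p\<^sub>i\<^sub>j = u\<^sub>i v\<^sub>j - u\<^sub>j v\<^sub>i\<close> for a basis \<open>u, v\<close> of the root
  space, one has \<open>\<alpha> = p\<^sub>0\<^sub>2 / p\<^sub>0\<^sub>1\<close> and \<open>\<beta> = p\<^sub>1\<^sub>2 / p\<^sub>0\<^sub>1\<close>, and \<open>s = p\<^sub>1\<^sub>2 p\<^sub>3\<^sub>0 / (p\<^sub>0\<^sub>2 p\<^sub>1\<^sub>3)\<close> is a cross ratio that satisfies
  \<open>s s\<^sub>2 = 1 + s\<^sub>1\<close> and \<open>N s = 1 / N \<alpha>\<close> because of the Plucker relations.  Solving for \<open>\<beta>\<close> gives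
  \<open>\<beta> = \<alpha> \<alpha>\<^sub>4 (1 + s\<^sub>4) = \<alpha> \<alpha>\<^sub>4 s\<^sub>3 s\<close>.
\<close>

lemma exists_q_polynomial_split_by_period_5:
  assumes "F (F (F (F (F \<alpha>)))) = \<alpha>" and "\<alpha> \<noteq> 0"
  obtains \<beta> where "\<beta> \<noteq> 0"
    "\<And>w. F (F w) = \<alpha> * F w - \<beta> * w \<Longrightarrow> F (F (F (F (F w)))) = w"
proof -
  define \<alpha>1 where "\<alpha>1 = F \<alpha>"
  define \<alpha>2 where "\<alpha>2 = F \<alpha>1"
  define \<alpha>3 where "\<alpha>3 = F \<alpha>2"
  define \<alpha>4 where "\<alpha>4 = F \<alpha>3"
  note \<alpha>_defs = \<alpha>1_def \<alpha>2_def \<alpha>3_def \<alpha>4_def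
  have F\<alpha>: "F \<alpha> = \<alpha>1" "F \<alpha>1 = \<alpha>2" "F \<alpha>2 = \<alpha>3" "F \<alpha>3 = \<alpha>4" "F \<alpha>4 = \<alpha>"
    using assms(1) by (simp_all add: \<alpha>_defs)
  have \<alpha>_nz: "\<alpha> \<noteq> 0" "\<alpha>1 \<noteq> 0" "\<alpha>2 \<noteq> 0" "\<alpha>3 \<noteq> 0" "\<alpha>4 \<noteq> 0"
    using assms(2) by (simp_all add: \<alpha>_defs)
  define c where "c = inverse (\<alpha> * \<alpha>1 * \<alpha>2 * \<alpha>3 * \<alpha>4)"
  have "F c = c" by (simp add: c_def F\<alpha> mult_ac)
  moreover have "c \<noteq> 0" using \<alpha>_nz by (simp add: c_def)
  ultimately obtain s where s: "s * F (F s) = 1 + F s"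
    "(1 + s) * (1 + F s) * (1 + s + F s) = c * s * F s"
    using exists_pentagon_orbit_of_norm by blast
  define s1 where "s1 = F s"
  define s2 where "s2 = F s1"
  define s3 where "s3 = F s2"
  define s4 where "s4 = F s3"
  define s5 where "s5 = F s4"
  note s_defs = s1_def s2_def s3_def s4_def s5_def
  have Fs: "F s = s1" "F s1 = s2" "F s2 = s3" "F s3 = s4" "F s4 = s5"
    by (simp_all add: s_defs)
  have R0: "s * s2 = 1 + s1" using s(1) by (simp add: s_defs)
  have R1: "s1 * s3 = 1 + s2" using arg_cong[OF R0, of F] by (simp add: Fs)
  have R2: "s2 * s4 = 1 + s3" using arg_cong[OF R1, of F] by (simp add: Fs)
  have R3: "s3 * s5 = 1 + s4" using arg_cong[OF R2, of F] by (simp add: Fs)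
  have "s \<noteq> 0" using s(1) by auto
  hence s_nz: "s \<noteq> 0" "s1 \<noteq> 0" "s2 \<noteq> 0" "s3 \<noteq> 0" "s4 \<noteq> 0"
    by (simp_all add: s_defs)
  note pent = pentagon_recurrence[OF R0 R1 R2 R3 s_nz(1-4)]
  have s5: "s5 = s" and R4: "s1 * s4 = 1 + s" using pent by auto
  have "s * s1 * s2 * s3 * s4 = c"
    using pent(3) s(2) s_nz Fs(1) by simp
  hence norm: "\<alpha> * \<alpha>1 * \<alpha>2 * \<alpha>3 * \<alpha>4 * (s * s1 * s2 * s3 * s4) = 1"
    using \<alpha>_nz unfolding c_def by (simp del: inverse_mult_distrib)
  define \<beta> where "\<beta> = \<alpha> * \<alpha>4 * (s * s3)"
  show thesis
  proof (rule that)
    show "\<beta> \<noteq> 0" using \<alpha>_nz s_nz by (simp add: \<beta>_def)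
    fix w0 assume w: "F (F w0) = \<alpha> * F w0 - \<beta> * w0"
    define w1 where "w1 = F w0"
    define w2 where "w2 = F w1"
    define w3 where "w3 = F w2"
    define w4 where "w4 = F w3"
    define w5 where "w5 = F w4"
    note w_defs = w1_def w2_def w3_def w4_def w5_def
    have Fw: "F w0 = w1" "F w1 = w2" "F w2 = w3" "F w3 = w4" "F w4 = w5"
      by (simp_all add: w_defs)
    have E2: "w2 = \<alpha> * w1 - \<alpha> * \<alpha>4 * (s * s3) * w0"
      using w by (simp add: Fw \<beta>_def)
    have E3: "w3 = \<alpha>1 * w2 - \<alpha>1 * \<alpha> * (s1 * s4) * w1"
      using arg_cong[OF E2, of F] by (simp add: Fw Fs F\<alpha>)
    have E4: "w4 = \<alpha>2 * w3 - \<alpha>2 * \<alpha>1 * (s2 * s) * w2"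
      using arg_cong[OF E3, of F] by (simp add: Fw Fs F\<alpha> s5)
    have E5: "w5 = \<alpha>3 * w4 - \<alpha>3 * \<alpha>2 * (s3 * s1) * w3"
      using arg_cong[OF E4, of F] by (simp add: Fw Fs F\<alpha> s5)
    have "w3 = - (\<alpha> * \<alpha>1 * s * (w1 + \<alpha>4 * s3 * w0))"
      using E2 E3 R4 by Groebner_Basis.algebra
    moreover from this have "w4 = - (\<alpha> * \<alpha>1 * \<alpha>2 * (s * s1 * s3) * (w1 - \<alpha>4 * w0))"
      using E2 E4 R0 R1 by Groebner_Basis.algebra
    ultimately have "w5 = \<alpha> * \<alpha>1 * \<alpha>2 * \<alpha>3 * \<alpha>4 * (s * s1 * s3 * (1 + s3)) * w0"
      using E5 by Groebner_Basis.algebra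
    also have "s * s1 * s3 * (1 + s3) = s * s1 * s2 * s3 * s4"
      using R2 by Groebner_Basis.algebra
    finally show "F (F (F (F (F w0)))) = w0"
      by (simp add: Fw norm)
  qed
qed

lemma card_roots_q_polynomial:
  assumes "\<beta> \<noteq> 0"
  shows "card {w. F (F w) = \<alpha> * F w - \<beta> * w} = q\<^sup>2"
proof -
  define L :: "'f poly" where "L = monom 1 (q\<^sup>2) - (smult \<alpha> (monom 1 q) - [:0, \<beta>:])"
  have "degree (smult \<alpha> (monom 1 q) - [:0, \<beta>:]) \<le> q"
    using q_ge_2 by (intro degree_diff_le order_trans[OF degree_smult_le] degree_monom_le) auto
  also have "q < q\<^sup>2" using q_ge_2 by (simp add: power2_eq_square)
  finally have deg: "degree L = q\<^sup>2"
    unfolding L_def by (subst degree_diff_eq_left) (simp_all add: degree_monom_eq)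
  hence "L \<noteq> 0" using q_ge_2 by auto
  have "pderiv L = [:\<beta>:]"
    by (simp add: L_def pderiv_diff pderiv_smult pderiv_monom pderiv_pCons of_nat_q)
  hence "card {w. poly L w = 0} = q\<^sup>2"
    using card_roots_eq_degree_if_separable[OF \<open>L \<noteq> 0\<close>] assms deg by simp
  moreover have "poly L w = 0 \<longleftrightarrow> F (F w) = \<alpha> * F w - \<beta> * w" for w
    by (simp add: L_def poly_monom F_def power2_eq_square power_mult mult_ac)
  ultimately show ?thesis by simp
qed

end

section \<open>The subfield\<close>

lemma field_embedding_0: "field_embedding \<iota> \<Longrightarrow> \<iota> 0 = 0"
  unfolding field_embedding_def by (metis add_cancel_right_right)

lemma field_embedding_inj:
  assumes "field_embedding \<iota>"
  shows "inj \<iota>"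
proof (rule injI)
  fix x y assume eq: "\<iota> x = \<iota> y"
  have "\<iota> (x - y) + \<iota> y = \<iota> x"
    using assms unfolding field_embedding_def by (metis diff_add_cancel)
  hence 0: "\<iota> (x - y) = 0" using eq by simp
  have "\<iota> ((x - y) * inverse (x - y)) = 0"
    using assms 0 by (simp add: field_embedding_def)
  thus "x = y"
    using assms by (cases "x = y") (auto simp: field_embedding_def)
qed

lemma field_embedding_power: "field_embedding \<iota> \<Longrightarrow> \<iota> (x ^ n) = \<iota> x ^ n"
  by (induction n) (auto simp: field_embedding_def)

lemma ext_dim_span_pair:
  assumes "field_embedding \<iota>" and "u \<noteq> 0" and "v \<notin> range (\<lambda>k. \<iota> k * u)"
  shows "ext_dim \<iota> (ext_span \<iota> {u, v}) = 2"
proof -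
  interpret vector_space "ext_scale \<iota>"
    by (rule vector_space_ext_scale[OF assms(1)])
  have "v \<notin> span {u}"
    using assms(3) by (auto simp: span_singleton ext_scale_def)
  hence "independent {v, u}"
    using assms(2) by (intro independent_insertI) (auto simp: independent_empty)
  moreover have "v \<noteq> u"
    using \<open>v \<notin> span {u}\<close> span_base[of u "{u}"] by auto
  ultimately show ?thesis
    using dim_span_eq_card_independent[of "{v, u}"] by (simp add: insert_commute)
qed

lemma primepow_eq_power_of_char:
  assumes "primepow q" and "card (UNIV :: 'a::finite_field set) = q ^ m"
  obtains n where "n > 0" "q = CHAR('a) ^ n"
proof -
  obtain p n where p: "prime p" "n > 0" "q = p ^ n"
    using assms(1) by (auto simp: primepow_def)
  have "prime CHAR('a)"
    by (intro prime_CHAR_semidom CHAR_pos)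
  moreover have "CHAR('a) dvd p ^ (n * m)"
    using CHAR_dvd_CARD[where ?'a = 'a] assms(2) p by (simp add: power_mult)
  ultimately have "CHAR('a) = p"
    using p(1) by (metis prime_dvd_power primes_dvd_imp_eq)
  thus thesis using that p by blast
qed

section \<open>Every nonzero element is a quotient of determinants\<close>

theorem lemma3p1:
  fixes q :: nat
    and \<iota> :: "'k::finite_field \<Rightarrow> 'a::finite_field"
    and b :: 'a
  assumes "primepow q" and "q \<ge> 223"
    and "card (UNIV :: 'k set) = q"
    and "card (UNIV :: 'a set) = q ^ 5"
    and "field_embedding \<iota>"
    and "b \<noteq> 0"
  shows "\<exists>u v :: 'a. u \<noteq> 0 \<and> v \<noteq> 0 \<and> ext_dim \<iota> (ext_span \<iota> {u, v}) = 2 \<and>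
           b = (u * v ^ q - u ^ q * v) / (u ^ (q ^ 2) * v - u * v ^ (q ^ 2))"
proof -
  obtain n where n: "n > 0" "q = CHAR('a) ^ n"
    using primepow_eq_power_of_char[OF assms(1,4)] by blast
  define F :: "'a alg_closure \<Rightarrow> 'a alg_closure" where "F = (\<lambda>x. x ^ q)"
  interpret frobenius_power F q n
    by standard (use n in \<open>simp_all add: F_def\<close>)
  have F5: "F (F (F (F (F x)))) = x ^ (q ^ 5)" for x
    by (simp add: F_def eval_nat_numeral mult_ac flip: power_mult)
  define \<alpha> where "\<alpha> = to_ac (- (1 / b))"
  have "F (F (F (F (F \<alpha>)))) = \<alpha>"
    unfolding F5 \<alpha>_def using finite_field_power_card_eq_same[of "- (1 / b)"] assms(4)
    by (metis to_ac_power)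
  moreover have "\<alpha> \<noteq> 0" using assms(6) by (simp add: \<alpha>_def)
  ultimately obtain \<beta> where \<beta>: "\<beta> \<noteq> 0"
    "\<And>w. F (F w) = \<alpha> * F w - \<beta> * w \<Longrightarrow> F (F (F (F (F w)))) = w"
    using exists_q_polynomial_split_by_period_5 by blast
  define W where "W = {w. F (F (to_ac w)) = \<alpha> * F (to_ac w) - \<beta> * to_ac w}"
  have "to_ac ` W = {w. F (F w) = \<alpha> * F w - \<beta> * w}"
  proof (intro equalityI subsetI)
    fix w assume "w \<in> {w. F (F w) = \<alpha> * F w - \<beta> * w}"
    moreover from this have "w \<in> range to_ac"
      using \<beta>(2)[of w]
      by (simp only: range_eq_power_fixed_points[OF inj_to_ac to_ac_power] assms(4) mem_Collect_eq flip: F5)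
    ultimately show "w \<in> to_ac ` W" by (auto simp: W_def)
  qed (auto simp: W_def)
  hence card_W: "card W = q\<^sup>2"
    using card_roots_q_polynomial[OF \<beta>(1), of \<alpha>]
    by (metis card_image inj_on_subset inj_to_ac subset_UNIV)

  have "\<not> W \<subseteq> {0}"
  proof
    assume "W \<subseteq> {0}"
    hence "q\<^sup>2 \<le> 1" using card_mono[of "{0}" W] card_W by simp
    thus False using assms(2) power_mono[of 2 q 2] by simp
  qed
  then obtain u where u: "u \<in> W" "u \<noteq> 0" by auto
  have "\<not> W \<subseteq> range (\<lambda>k. \<iota> k * u)"
  proof
    assume "W \<subseteq> range (\<lambda>k. \<iota> k * u)"
    hence "q\<^sup>2 \<le> card (range (\<lambda>k. \<iota> k * u))"
      using card_mono[of "range (\<lambda>k. \<iota> k * u)" W] card_W by simp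
    also have "\<dots> \<le> q" using card_image_le[of "UNIV :: 'k set"] assms(3) by simp
    finally show False using assms(2) by (simp add: power2_eq_square)
  qed
  then obtain v where v: "v \<in> W" "v \<notin> range (\<lambda>k. \<iota> k * u)" by auto
  have "v \<noteq> 0"
    using v(2) rangeI[of "\<lambda>k. \<iota> k * u" 0] field_embedding_0[OF assms(5)] by auto

  have "v / u \<notin> range \<iota>"
    using v(2) u(2) by (auto simp: image_iff field_simps)
  hence "(v / u) ^ q \<noteq> v / u"
    using range_eq_power_fixed_points[OF field_embedding_inj[OF assms(5)] field_embedding_power[OF assms(5)]]
      assms(3) by auto
  hence wronskian: "u * v ^ q - u ^ q * v \<noteq> 0"
    using u(2) by (auto simp: power_divide field_simps)
  define D where "D = u * v ^ q - u ^ q * v"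
  have F2: "F (F x) = x ^ (q\<^sup>2)" for x
    by (simp add: F_def power2_eq_square power_mult)
  have "to_ac (u ^ (q\<^sup>2) * v - u * v ^ (q\<^sup>2)) = F (F (to_ac u)) * to_ac v - to_ac u * F (F (to_ac v))"
    by (simp add: F2)
  also have "\<dots> = (\<alpha> * F (to_ac u) - \<beta> * to_ac u) * to_ac v - to_ac u * (\<alpha> * F (to_ac v) - \<beta> * to_ac v)"
    using u(1) v(1) by (simp add: W_def)
  also have "\<dots> = - \<alpha> * (to_ac u * F (to_ac v) - F (to_ac u) * to_ac v)"
    by (simp add: algebra_simps)
  also have "\<dots> = to_ac (1 / b * D)"
    by (simp add: \<alpha>_def F_def D_def)
  finally have "u ^ (q\<^sup>2) * v - u * v ^ (q\<^sup>2) = 1 / b * D"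
    by (simp only: to_ac_eq_iff)
  hence "b = (u * v ^ q - u ^ q * v) / (u ^ (q\<^sup>2) * v - u * v ^ (q\<^sup>2))"
    using wronskian assms(6) by (simp add: D_def)
  moreover have "ext_dim \<iota> (ext_span \<iota> {u, v}) = 2"
    using ext_dim_span_pair[OF assms(5) u(2) v(2)] .
  ultimately show ?thesis using u(2) \<open>v \<noteq> 0\<close> by blast
qed

end
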